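(* Let $\Phi,\Psi$ be dimension functions and let $\mu$ be a Borel probability measure on a bounded metric space. (1) If $\Phi(x)/\Psi(x)\to1$ as $x\to0$, then $\overline{\dim}_\Phi\mu=\overline{\dim}_\Psi\mu$. If, in addition, $\mu$ is doubling, then also $\underline{\dim}_\Phi\mu=\underline{\dim}_\Psi\mu$. (2) If $\Phi(x)\to\theta\ne0$ as $x\to0$, then $\overline{\dim}_\Phi\mu=\overline{\dim}_{\Phi_\theta}\mu$, where $\Phi_\theta$ is the constant function $\theta$. (3) If $\Phi\sim\Psi$, then $\overline{\dim}_\Phi\mu<\infty$ if and only if $\overline{\dim}_\Psi\mu<\infty$. In particular, if $\Phi$ and $\Psi$ are positive constant functions, then $\overline{\dim}_\Phi\mu<\infty$ if and only if $\overline{\dim}_\Psi\mu<\infty$.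
   Context: A dimension function is a map $\Phi:(0,1)\to[0,\infty)$ such that $x^{1+\Phi(x)}$ decreases to $0$ as $x$ decreases to $0$. $f\sim g$ means there are constants $a,b>0$ with $af(x)\le g(x)\le bf(x)$ for all $x$ in the domain. $B(x,R)$ is the open ball of centre $x$ and radius $R$. $\overline{\dim}_\Phi\mu$ is the infimum of all $\alpha$ for which there exist $C_1,C_2>0$ such that for all $0<r<R^{1+\Phi(R)}\le R\le C_1$ and all $x\in\mathrm{supp}\,\mu$, $\mu(B(x,R))/\mu(B(x,r))\le C_2(R/r)^\alpha$; $\underline{\dim}_\Phi\mu$ is the supremum of all $\alpha$ for which there exist $C_1,C_2>0$ such that for the same $r,R,x$, $\mu(B(x,R))/\mu(B(x,r))\ge C_2(R/r)^\alpha$. Values in $[0,\infty]$ are allowed. $\mu$ (on $X$) is doubling if there is a constant $C$ with $\mu(B(z,2R))\le C\mu(B(z,R))$ for all $R\le\mathrm{diam}\,X$ and $z\in\mathrm{supp}\,\mu$. *)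

theory Defs
  imports "HOL-Probability.Probability"
begin

text \<open>A dimension function lives on the interval (0,1); it is represented by a total function on
  the reals of which only the values on (0,1) are ever used. ``Decreases'' is understood in the
  weak sense.\<close>

definition dimension_function :: "(real \<Rightarrow> real) \<Rightarrow> bool" where
  "dimension_function \<Phi> \<longleftrightarrow>
     (\<forall>x\<in>{0<..<1}. 0 \<le> \<Phi> x) \<and>
     mono_on {0<..<1} (\<lambda>x. x powr (1 + \<Phi> x)) \<and>
     ((\<lambda>x. x powr (1 + \<Phi> x)) \<longlongrightarrow> 0) (at_right 0)"

definition comparable :: "(real \<Rightarrow> real) \<Rightarrow> (real \<Rightarrow> real) \<Rightarrow> bool" where
  "comparable f g \<longleftrightarrow> (\<exists>a>0. \<exists>b>0. \<forall>x\<in>{0<..<1}. a * f x \<le> g x \<and> g x \<le> b * f x)"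

definition supp :: "'a::metric_space measure \<Rightarrow> 'a set" where
  "supp \<mu> = {x. \<forall>r>0. 0 < measure \<mu> (ball x r)}"

text \<open>The scales over which both dimensions quantify. The condition that \<open>R\<close> lies in (0,1) is the
  domain condition on \<open>\<Phi>\<close>; it is not automatic, because \<open>C\<^sub>1\<close> may be 1 or larger.\<close>

definition admissible_scales :: "(real \<Rightarrow> real) \<Rightarrow> real \<Rightarrow> real \<Rightarrow> real \<Rightarrow> bool" where
  "admissible_scales \<Phi> C\<^sub>1 r R \<longleftrightarrow>
     R \<in> {0<..<1} \<and> 0 < r \<and> r < R powr (1 + \<Phi> R) \<and> R powr (1 + \<Phi> R) \<le> R \<and> R \<le> C\<^sub>1"

text \<open>The exponents range over the nonnegative reals, so that the dimensions take values in
  \<open>[0,\<infinity>]\<close>, with the infimum of the empty set being \<open>\<infinity>\<close>. If the support is nonempty, admitting negative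
  exponents would change neither dimension. The denominators below are positive because \<open>x\<close> is in the
  support.\<close>

definition upper_dim :: "(real \<Rightarrow> real) \<Rightarrow> 'a::metric_space measure \<Rightarrow> ennreal" where
  "upper_dim \<Phi> \<mu> = Inf {ennreal \<alpha> | \<alpha>. 0 \<le> \<alpha> \<and>
     (\<exists>C\<^sub>1>0. \<exists>C\<^sub>2>0. \<forall>r R. admissible_scales \<Phi> C\<^sub>1 r R \<longrightarrow>
        (\<forall>x\<in>supp \<mu>. measure \<mu> (ball x R) / measure \<mu> (ball x r) \<le> C\<^sub>2 * (R / r) powr \<alpha>))}"

definition lower_dim :: "(real \<Rightarrow> real) \<Rightarrow> 'a::metric_space measure \<Rightarrow> ennreal" where
  "lower_dim \<Phi> \<mu> = Sup {ennreal \<alpha> | \<alpha>. 0 \<le> \<alpha> \<and>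
     (\<exists>C\<^sub>1>0. \<exists>C\<^sub>2>0. \<forall>r R. admissible_scales \<Phi> C\<^sub>1 r R \<longrightarrow>
        (\<forall>x\<in>supp \<mu>. measure \<mu> (ball x R) / measure \<mu> (ball x r) \<ge> C\<^sub>2 * (R / r) powr \<alpha>))}"

text \<open>The ambient space \<open>X\<close> is the whole type \<open>'a\<close>. Its \<open>diameter\<close> is the genuine one
  only when the space is bounded.\<close>

definition doubling :: "'a::metric_space measure \<Rightarrow> bool" where
  "doubling \<mu> \<longleftrightarrow>
     (\<exists>C. \<forall>R z. 0 < R \<and> R \<le> diameter (UNIV :: 'a set) \<and> z \<in> supp \<mu> \<longrightarrow>
        measure \<mu> (ball z (2 * R)) \<le> C * measure \<mu> (ball z R))"

end

theory Submission
  imports Defs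
begin

text \<open>Everything rests on replacing the small radius. Suppose \<open>\<Phi> R \<le> k * \<Psi> R\<close> with \<open>k \<ge> 1\<close>, and
  let \<open>r < R powr (1 + \<Psi> R)\<close>. If \<open>r\<close> is too large to be a small radius for \<open>\<Phi>\<close>, shrink it to
  \<open>r' = R powr (1 + \<Phi> R) / 2\<close>. Since \<open>R / r\<close> exceeds \<open>R powr - \<Psi> R\<close>, the new quotient
  \<open>R / r' = 2 * R powr - \<Phi> R\<close> is at most \<open>2 * (R / r) powr k\<close> (\<open>shrink_scale\<close>).

  For the upper dimension shrinking can only increase the quotient of measures, so a growth exponent
  \<open>\<alpha>\<close> for \<open>\<Phi>\<close> becomes the exponent \<open>k * \<alpha>\<close> for \<open>\<Psi>\<close>. A single constant \<open>k\<close> therefore preserves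
  finiteness, and constants \<open>k\<close> arbitrarily close to 1 preserve the dimension itself. A limit
  \<open>\<theta> \<noteq> 0\<close> of \<open>\<Phi>\<close> is positive, so that \<open>\<Phi> / \<theta>\<close> tends to 1 and the comparison applies to the
  constant function.

  For the lower dimension the shrinking goes in the wrong direction, and one has to pay for passing
  from \<open>r'\<close> back to \<open>r\<close>. Doubling bounds this cost by a power of \<open>r / r'\<close>, which is at most
  \<open>2 * (R / r) powr (k - 1)\<close>; the exponent drops by a multiple of \<open>k - 1\<close>, which disappears as
  \<open>k\<close> tends to 1.\<close>

section \<open>Growth exponents\<close>

definition upper_exponent :: "(real \<Rightarrow> real) \<Rightarrow> 'a::metric_space measure \<Rightarrow> real \<Rightarrow> bool" where
  "upper_exponent \<Phi> \<mu> \<alpha> \<longleftrightarrow> 0 \<le> \<alpha> \<and>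
     (\<exists>C\<^sub>1>0. \<exists>C\<^sub>2>0. \<forall>r R. admissible_scales \<Phi> C\<^sub>1 r R \<longrightarrow>
        (\<forall>x\<in>supp \<mu>. measure \<mu> (ball x R) / measure \<mu> (ball x r) \<le> C\<^sub>2 * (R / r) powr \<alpha>))"

definition lower_exponent :: "(real \<Rightarrow> real) \<Rightarrow> 'a::metric_space measure \<Rightarrow> real \<Rightarrow> bool" where
  "lower_exponent \<Phi> \<mu> \<alpha> \<longleftrightarrow> 0 \<le> \<alpha> \<and>
     (\<exists>C\<^sub>1>0. \<exists>C\<^sub>2>0. \<forall>r R. admissible_scales \<Phi> C\<^sub>1 r R \<longrightarrow>
        (\<forall>x\<in>supp \<mu>. measure \<mu> (ball x R) / measure \<mu> (ball x r) \<ge> C\<^sub>2 * (R / r) powr \<alpha>))"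

lemma upper_dim_eq_Inf: "upper_dim \<Phi> \<mu> = Inf {ennreal \<alpha> | \<alpha>. upper_exponent \<Phi> \<mu> \<alpha>}"
  by (simp add: upper_dim_def upper_exponent_def)

lemma lower_dim_eq_Sup: "lower_dim \<Phi> \<mu> = Sup {ennreal \<alpha> | \<alpha>. lower_exponent \<Phi> \<mu> \<alpha>}"
  by (simp add: lower_dim_def lower_exponent_def)

lemma upper_dim_le: "upper_exponent \<Phi> \<mu> \<alpha> \<Longrightarrow> upper_dim \<Phi> \<mu> \<le> ennreal \<alpha>"
  unfolding upper_dim_eq_Inf by (rule Inf_lower) auto

lemma le_lower_dim: "lower_exponent \<Phi> \<mu> \<alpha> \<Longrightarrow> ennreal \<alpha> \<le> lower_dim \<Phi> \<mu>"
  unfolding lower_dim_eq_Sup by (rule Sup_upper) auto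

lemma upper_dim_finite_iff: "upper_dim \<Phi> \<mu> < \<infinity> \<longleftrightarrow> (\<exists>\<alpha>. upper_exponent \<Phi> \<mu> \<alpha>)"
  unfolding upper_dim_eq_Inf by (auto simp: Inf_less_iff)

lemma measure_ball_mono:
  fixes \<mu> :: "'a::metric_space measure"
  assumes "prob_space \<mu>" "sets \<mu> = sets borel" "r \<le> R"
  shows "measure \<mu> (ball x r) \<le> measure \<mu> (ball x R)"
proof -
  interpret prob_space \<mu> by fact
  show ?thesis
    by (rule finite_measure_mono) (use assms in \<open>auto simp: subset_ball\<close>)
qed

section \<open>Changing the small radius\<close>

text \<open>The factor 2 comes from the strict inequality that a small radius has to satisfy: halving
  \<open>R powr (1 + \<Phi> R)\<close> is a convenient way to get strictly below it.\<close>

lemma shrink_scale: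
  assumes adm: "admissible_scales \<Psi> C r R"
    and "0 \<le> \<Phi> R" "\<Phi> R \<le> k * \<Psi> R" "1 \<le> k"
  obtains r' where "admissible_scales \<Phi> C r' R" "r' \<le> r" "R / r' \<le> 2 * (R / r) powr k"
proof -
  have R: "0 < R" "R < 1" and r: "0 < r" "r < R powr (1 + \<Psi> R)" "r \<le> R" "R \<le> C"
    using adm by (auto simp: admissible_scales_def)
  have Rle: "R powr (1 + \<Phi> R) \<le> R"
    using powr_mono'[of 1 "1 + \<Phi> R" R] R assms by simp
  have q: "1 \<le> R / r" using r by simp
  show thesis
  proof (cases "r < R powr (1 + \<Phi> R)")
    case True
    have "R / r \<le> (R / r) powr k"
      using powr_mono[of 1 k "R / r"] q assms R r by simp
    hence "R / r \<le> 2 * (R / r) powr k" using q by linarith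
    moreover have "admissible_scales \<Phi> C r R"
      using True R r Rle by (simp add: admissible_scales_def)
    ultimately show thesis using that by blast
  next
    case False
    let ?r' = "R powr (1 + \<Phi> R) / 2"
    have pos: "0 < R powr (1 + \<Phi> R)" using R by simp
    have "R powr (- \<Psi> R) \<le> R / r"
      using r R by (simp add: powr_minus powr_add field_simps)
    hence "(R powr (- \<Psi> R)) powr k \<le> (R / r) powr k"
      using assms by (intro powr_mono2) auto
    moreover have "R powr (- \<Phi> R) \<le> (R powr (- \<Psi> R)) powr k"
      using powr_mono'[of "- (k * \<Psi> R)" "- \<Phi> R" R] R assms by (simp add: powr_powr mult.commute)
    moreover have "R / ?r' = 2 * R powr (- \<Phi> R)"
      using R by (simp add: powr_minus powr_add field_simps)
    ultimately have "R / ?r' \<le> 2 * (R / r) powr k" by simp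
    moreover have "admissible_scales \<Phi> C ?r' R"
      using R r Rle pos unfolding admissible_scales_def by auto
    moreover have "?r' \<le> r" using False pos by linarith
    ultimately show thesis using that by blast
  qed
qed

text \<open>The bound \<open>C\<^sub>1\<close> on the large radius may always be decreased, so an inequality between \<open>\<Phi>\<close> and
  \<open>\<Psi>\<close> that holds only near 0 is as good as one that holds everywhere.\<close>

lemma shrink_scale_eventually:
  assumes ev: "\<forall>\<^sub>F x in at_right 0. \<Phi> x \<le> k * \<Psi> x"
    and nonneg: "\<forall>x\<in>{0<..<1}. 0 \<le> \<Phi> x" and k: "1 \<le> k" and C: "0 < C"
  obtains C' where "0 < C'" "\<And>r R. admissible_scales \<Psi> C' r R \<Longrightarrow>
    \<exists>r'. admissible_scales \<Phi> C r' R \<and> r' \<le> r \<and> R / r' \<le> 2 * (R / r) powr k"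
proof -
  obtain b where b: "0 < b" "\<And>x. 0 < x \<Longrightarrow> x < b \<Longrightarrow> \<Phi> x \<le> k * \<Psi> x"
    using ev by (auto simp: eventually_at_right_field)
  show thesis
  proof (rule that)
    show "0 < min C (b / 2)" using b C by simp
    fix r R assume adm: "admissible_scales \<Psi> (min C (b / 2)) r R"
    have R: "0 < R" "R < 1" "R < b" using adm b(1) by (auto simp: admissible_scales_def)
    have adm': "admissible_scales \<Psi> C r R" using adm by (auto simp: admissible_scales_def)
    have nonneg': "0 \<le> \<Phi> R" using nonneg R by simp
    show "\<exists>r'. admissible_scales \<Phi> C r' R \<and> r' \<le> r \<and> R / r' \<le> 2 * (R / r) powr k"
      by (rule shrink_scale[where \<Phi> = \<Phi> and R = R, OF adm' nonneg' b(2)[OF R(1,3)] k]) blast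
  qed
qed

section \<open>The upper dimension\<close>

lemma upper_exponent_transfer:
  fixes \<mu> :: "'a::metric_space measure"
  assumes ps: "prob_space \<mu>" "sets \<mu> = sets borel"
    and ev: "\<forall>\<^sub>F x in at_right 0. \<Phi> x \<le> k * \<Psi> x"
    and nonneg: "\<forall>x\<in>{0<..<1}. 0 \<le> \<Phi> x" and k: "1 \<le> k"
    and \<alpha>: "upper_exponent \<Phi> \<mu> \<alpha>"
  shows "upper_exponent \<Psi> \<mu> (k * \<alpha>)"
proof -
  obtain C1 C2 where C: "0 \<le> \<alpha>" "0 < C1" "0 < C2" and
    bound: "\<And>r R x. admissible_scales \<Phi> C1 r R \<Longrightarrow> x \<in> supp \<mu> \<Longrightarrow>
       measure \<mu> (ball x R) / measure \<mu> (ball x r) \<le> C2 * (R / r) powr \<alpha>"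
    using \<alpha> unfolding upper_exponent_def by blast
  obtain C' where C': "0 < C'" and shrink: "\<And>r R. admissible_scales \<Psi> C' r R \<Longrightarrow>
      \<exists>r'. admissible_scales \<Phi> C1 r' R \<and> r' \<le> r \<and> R / r' \<le> 2 * (R / r) powr k"
    using shrink_scale_eventually[OF ev nonneg k C(2)] by blast
  have "measure \<mu> (ball x R) / measure \<mu> (ball x r) \<le> (C2 * 2 powr \<alpha>) * (R / r) powr (k * \<alpha>)"
    if adm: "admissible_scales \<Psi> C' r R" and x: "x \<in> supp \<mu>" for r R x
  proof -
    obtain r' where r': "admissible_scales \<Phi> C1 r' R" "r' \<le> r" "R / r' \<le> 2 * (R / r) powr k"
      using shrink[OF adm] by blast
    have pos: "0 < R" "0 < r" "0 < r'"
      using adm r' by (auto simp: admissible_scales_def)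
    have "measure \<mu> (ball x R) / measure \<mu> (ball x r) \<le> measure \<mu> (ball x R) / measure \<mu> (ball x r')"
      using x pos measure_ball_mono[OF ps r'(2)] by (intro divide_left_mono) (auto simp: supp_def)
    also have "\<dots> \<le> C2 * (R / r') powr \<alpha>" by (rule bound) fact+
    also have "\<dots> \<le> C2 * (2 * (R / r) powr k) powr \<alpha>"
      using C pos r' by (intro mult_left_mono powr_mono2) auto
    also have "\<dots> = (C2 * 2 powr \<alpha>) * (R / r) powr (k * \<alpha>)"
      using pos by (simp add: powr_mult powr_powr)
    finally show ?thesis .
  qed
  moreover have "0 < C2 * 2 powr \<alpha>" "0 \<le> k * \<alpha>" using C k by auto
  ultimately show ?thesis using C' unfolding upper_exponent_def by blast
qed

lemma upper_dim_mono_asymptotic: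
  fixes \<mu> :: "'a::metric_space measure"
  assumes ps: "prob_space \<mu>" "sets \<mu> = sets borel"
    and ev: "\<And>k. 1 < k \<Longrightarrow> \<forall>\<^sub>F x in at_right 0. \<Phi> x \<le> k * \<Psi> x"
    and nonneg: "\<forall>x\<in>{0<..<1}. 0 \<le> \<Phi> x"
  shows "upper_dim \<Psi> \<mu> \<le> upper_dim \<Phi> \<mu>"
proof -
  have "upper_dim \<Psi> \<mu> \<le> ennreal \<alpha>" if \<alpha>: "upper_exponent \<Phi> \<mu> \<alpha>" for \<alpha>
  proof (rule ennreal_le_epsilon)
    fix e :: real assume e: "0 < e"
    have \<alpha>0: "0 \<le> \<alpha>" using \<alpha> by (simp add: upper_exponent_def)
    (* chosen so that k * \<alpha> \<le> \<alpha> + e, also when \<alpha> = 0 *)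
    define k where "k = 1 + e / (\<alpha> + 1)"
    have k: "1 < k" using e \<alpha>0 by (simp add: k_def)
    have "upper_dim \<Psi> \<mu> \<le> ennreal (k * \<alpha>)"
      using upper_exponent_transfer[OF ps ev[OF k] nonneg _ \<alpha>] k by (intro upper_dim_le) simp
    also have "k * \<alpha> \<le> \<alpha> + e"
      using e \<alpha>0 by (simp add: k_def field_simps)
    hence "ennreal (k * \<alpha>) \<le> ennreal \<alpha> + ennreal e"
      using e \<alpha>0 by (simp flip: ennreal_plus add: ennreal_leI)
    finally show "upper_dim \<Psi> \<mu> \<le> ennreal \<alpha> + ennreal e" .
  qed
  thus ?thesis unfolding upper_dim_eq_Inf[of \<Phi>] by (intro Inf_greatest) blast
qed

lemma upper_dim_finite_transfer:
  fixes \<mu> :: "'a::metric_space measure"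
  assumes ps: "prob_space \<mu>" "sets \<mu> = sets borel"
    and le: "\<forall>x\<in>{0<..<1}. \<Phi> x \<le> k * \<Psi> x"
    and nonneg: "\<forall>x\<in>{0<..<1}. 0 \<le> \<Phi> x" "\<forall>x\<in>{0<..<1}. 0 \<le> \<Psi> x"
    and fin: "upper_dim \<Phi> \<mu> < \<infinity>"
  shows "upper_dim \<Psi> \<mu> < \<infinity>"
proof -
  obtain \<alpha> where \<alpha>: "upper_exponent \<Phi> \<mu> \<alpha>" using fin unfolding upper_dim_finite_iff by blast
  have "\<Phi> x \<le> max k 1 * \<Psi> x" if "0 < x" "x < 1" for x
  proof -
    have "\<Phi> x \<le> k * \<Psi> x" using le that by simp
    also have "\<dots> \<le> max k 1 * \<Psi> x" using nonneg that by (intro mult_right_mono) auto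
    finally show ?thesis .
  qed
  hence "\<forall>\<^sub>F x in at_right 0. \<Phi> x \<le> max k 1 * \<Psi> x"
    unfolding eventually_at_right_field by (intro exI[of _ 1]) auto
  from upper_exponent_transfer[OF ps this nonneg(1) _ \<alpha>] show ?thesis
    unfolding upper_dim_finite_iff by auto
qed

lemma comparable_upper_dim_finite_iff:
  fixes \<mu> :: "'a::metric_space measure"
  assumes ps: "prob_space \<mu>" "sets \<mu> = sets borel"
    and nonneg: "\<forall>x\<in>{0<..<1}. 0 \<le> \<Phi> x" "\<forall>x\<in>{0<..<1}. 0 \<le> \<Psi> x"
    and comp: "comparable \<Phi> \<Psi>"
  shows "upper_dim \<Phi> \<mu> < \<infinity> \<longleftrightarrow> upper_dim \<Psi> \<mu> < \<infinity>"
proof -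
  obtain a b where ab: "0 < a" "0 < b" "\<forall>x\<in>{0<..<1}. a * \<Phi> x \<le> \<Psi> x \<and> \<Psi> x \<le> b * \<Phi> x"
    using comp unfolding comparable_def by blast
  have "\<forall>x\<in>{0<..<1}. \<Phi> x \<le> (1 / a) * \<Psi> x" using ab by (simp add: field_simps)
  moreover have "\<forall>x\<in>{0<..<1}. \<Psi> x \<le> b * \<Phi> x" using ab by blast
  ultimately show ?thesis
    using upper_dim_finite_transfer[OF ps _ nonneg] upper_dim_finite_transfer[OF ps _ nonneg(2,1)]
    by blast
qed

section \<open>The lower dimension of a doubling measure\<close>

text \<open>Iterating the doubling inequality: \<open>t\<close> is at most \<open>2 ^ n * u\<close> for an \<open>n\<close> with
  \<open>2 ^ n < 2 * (t / u)\<close>, and \<open>C ^ n = (2 ^ n) powr log 2 C\<close>. Radii beyond the diameter of the space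
  cause no trouble, because the ball is then already the whole space.\<close>

lemma doubling_power_growth:
  fixes \<mu> :: "'a::metric_space measure"
  assumes ps: "prob_space \<mu>" "sets \<mu> = sets borel"
    and bdd: "bounded (UNIV :: 'a set)" and doub: "doubling \<mu>"
  obtains D s where "0 < D" "0 \<le> s" "\<And>u t z. 0 < u \<Longrightarrow> u \<le> t \<Longrightarrow> z \<in> supp \<mu> \<Longrightarrow>
    measure \<mu> (ball z t) \<le> D * (t / u) powr s * measure \<mu> (ball z u)"
proof -
  obtain C0 where C0: "\<And>R z. 0 < R \<Longrightarrow> R \<le> diameter (UNIV :: 'a set) \<Longrightarrow> z \<in> supp \<mu> \<Longrightarrow>
      measure \<mu> (ball z (2 * R)) \<le> C0 * measure \<mu> (ball z R)"
    using doub unfolding doubling_def by blast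
  define C where "C = max C0 1"
  have C1: "1 \<le> C" by (simp add: C_def)
  have step: "measure \<mu> (ball z (2 * R)) \<le> C * measure \<mu> (ball z R)"
    if R: "0 < R" and z: "z \<in> supp \<mu>" for R z
  proof (cases "R \<le> diameter (UNIV :: 'a set)")
    case True
    have "measure \<mu> (ball z (2 * R)) \<le> C0 * measure \<mu> (ball z R)" by (rule C0) fact+
    also have "\<dots> \<le> C * measure \<mu> (ball z R)" by (intro mult_right_mono) (auto simp: C_def)
    finally show ?thesis .
  next
    case False
    have "dist z y < R" for y
      using False diameter_bounded_bound[OF bdd, of z y] by simp
    hence sub: "ball z (2 * R) \<subseteq> ball z R" by (simp add: subset_iff)
    have "ball z R \<subseteq> ball z (2 * R)" using R by (intro subset_ball) simp
    with sub have "ball z (2 * R) = ball z R" by (rule subset_antisym)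
    hence "measure \<mu> (ball z (2 * R)) = 1 * measure \<mu> (ball z R)" by simp
    also have "\<dots> \<le> C * measure \<mu> (ball z R)"
      using C1 by (intro mult_right_mono) auto
    finally show ?thesis .
  qed
  have iter: "measure \<mu> (ball z (2 ^ n * u)) \<le> C ^ n * measure \<mu> (ball z u)"
    if "0 < u" "z \<in> supp \<mu>" for n u z
  proof (induction n)
    case (Suc n)
    have "measure \<mu> (ball z (2 ^ Suc n * u)) \<le> C * measure \<mu> (ball z (2 ^ n * u))"
      using step[of "2 ^ n * u" z] that by (simp add: mult.assoc)
    also have "\<dots> \<le> C * (C ^ n * measure \<mu> (ball z u))"
      using Suc C1 by (intro mult_left_mono) auto
    finally show ?case by (simp add: mult.assoc)
  qed simp
  show thesis
  proof (rule that)
    show "0 < C" "0 \<le> log 2 C" using C1 by auto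
    fix u t :: real and z assume ut: "0 < u" "u \<le> t" and z: "z \<in> supp \<mu>"
    define n where "n = nat \<lceil>log 2 (t / u)\<rceil>"
    have q: "1 \<le> t / u" using ut by simp
    hence "0 \<le> log 2 (t / u)" by simp
    hence n: "log 2 (t / u) \<le> n" "n \<le> log 2 (t / u) + 1"
      unfolding n_def by linarith+
    have "t / u = 2 powr log 2 (t / u)" using ut by simp
    also have "\<dots> \<le> 2 powr n" using n(1) by (intro powr_mono) auto
    finally have "t \<le> 2 ^ n * u" using ut by (simp add: powr_realpow field_simps)
    hence "measure \<mu> (ball z t) \<le> C ^ n * measure \<mu> (ball z u)"
      using iter[OF ut(1) z, of n] measure_ball_mono[OF ps, of t "2 ^ n * u" z] by linarith
    also have "C ^ n \<le> C * (t / u) powr log 2 C"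
    proof -
      have "C ^ n = C powr n" using C1 by (simp add: powr_realpow)
      also have "\<dots> \<le> C powr (log 2 (t / u) + 1)" using n(2) C1 by (intro powr_mono) auto
      also have "\<dots> = C * C powr log 2 (t / u)" using C1 by (simp add: powr_add)
      also have "C powr log 2 (t / u) = (t / u) powr log 2 C"
        using C1 ut by (simp add: powr_def log_def)
      finally show ?thesis .
    qed
    hence "C ^ n * measure \<mu> (ball z u) \<le> C * (t / u) powr log 2 C * measure \<mu> (ball z u)"
      by (intro mult_right_mono) auto
    finally show "measure \<mu> (ball z t) \<le> C * (t / u) powr log 2 C * measure \<mu> (ball z u)" .
  qed
qed

text \<open>Here \<open>s * (k - 1)\<close> is the loss in the exponent incurred by enlarging the small radius again, in
  a measure whose balls grow at most like the power \<open>s\<close> of the radius.\<close>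

lemma lower_exponent_transfer:
  fixes \<mu> :: "'a::metric_space measure"
  assumes D: "0 < D" and s: "0 \<le> s" and growth: "\<And>u t z. 0 < u \<Longrightarrow> u \<le> t \<Longrightarrow> z \<in> supp \<mu> \<Longrightarrow>
      measure \<mu> (ball z t) \<le> D * (t / u) powr s * measure \<mu> (ball z u)"
    and ev: "\<forall>\<^sub>F x in at_right 0. \<Phi> x \<le> k * \<Psi> x"
    and nonneg: "\<forall>x\<in>{0<..<1}. 0 \<le> \<Phi> x" and k: "1 \<le> k"
    and \<alpha>: "lower_exponent \<Phi> \<mu> \<alpha>" and \<beta>: "0 \<le> \<beta>" "\<beta> + s * (k - 1) \<le> \<alpha>"
  shows "lower_exponent \<Psi> \<mu> \<beta>"
proof -
  obtain C1 C2 where C: "0 \<le> \<alpha>" "0 < C1" "0 < C2" and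
    bound: "\<And>r R x. admissible_scales \<Phi> C1 r R \<Longrightarrow> x \<in> supp \<mu> \<Longrightarrow>
       C2 * (R / r) powr \<alpha> \<le> measure \<mu> (ball x R) / measure \<mu> (ball x r)"
    using \<alpha> unfolding lower_exponent_def by blast
  obtain C' where C': "0 < C'" and shrink: "\<And>r R. admissible_scales \<Psi> C' r R \<Longrightarrow>
      \<exists>r'. admissible_scales \<Phi> C1 r' R \<and> r' \<le> r \<and> R / r' \<le> 2 * (R / r) powr k"
    using shrink_scale_eventually[OF ev nonneg k C(2)] by blast
  let ?K = "D * 2 powr s"
  have K: "0 < ?K" using D by simp
  have "(C2 / ?K) * (R / r) powr \<beta> \<le> measure \<mu> (ball x R) / measure \<mu> (ball x r)"
    if adm: "admissible_scales \<Psi> C' r R" and x: "x \<in> supp \<mu>" for r R x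
  proof -
    obtain r' where r': "admissible_scales \<Phi> C1 r' R" "r' \<le> r" "R / r' \<le> 2 * (R / r) powr k"
      using shrink[OF adm] by blast
    have pos: "0 < R" "0 < r" "0 < r'" and "r \<le> R"
      using adm r' by (auto simp: admissible_scales_def)
    let ?q = "R / r"
    let ?m = "\<lambda>t. measure \<mu> (ball x t)"
    have q: "1 \<le> ?q" using pos \<open>r \<le> R\<close> by simp
    have m: "0 < ?m t" if "0 < t" for t using x that by (simp add: supp_def)
    have "r / r' = (R / r') / ?q" using pos by simp
    also have "\<dots> \<le> (2 * ?q powr k) / ?q" using r' pos by (intro divide_right_mono) auto
    also have "\<dots> = 2 * ?q powr (k - 1)" using pos by (simp add: powr_diff)
    finally have "(r / r') powr s \<le> (2 * ?q powr (k - 1)) powr s"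
      using pos s by (intro powr_mono2) auto
    also have "\<dots> = 2 powr s * ?q powr (s * (k - 1))"
      using pos by (simp add: powr_mult powr_powr mult.commute)
    finally have "D * (r / r') powr s * ?m r' \<le> D * (2 powr s * ?q powr (s * (k - 1))) * ?m r'"
      using D by (intro mult_right_mono mult_left_mono) auto
    hence cost: "?m r \<le> ?K * ?q powr (s * (k - 1)) * ?m r'"
      using growth[OF pos(3) r'(2) x] by (simp add: mult.assoc)
    have "C2 * ?q powr \<beta> * ?m r \<le> C2 * ?q powr \<beta> * (?K * ?q powr (s * (k - 1)) * ?m r')"
      using C cost by (intro mult_left_mono) auto
    also have "\<dots> = ?K * (C2 * ?q powr (\<beta> + s * (k - 1)) * ?m r')"
      by (simp add: powr_add)
    also have "\<dots> \<le> ?K * (C2 * (R / r') powr \<alpha> * ?m r')"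
    proof -
      have "?q powr (\<beta> + s * (k - 1)) \<le> ?q powr \<alpha>" using q \<beta> by (intro powr_mono) auto
      also have "\<dots> \<le> (R / r') powr \<alpha>"
        using C pos r' by (intro powr_mono2 divide_left_mono) auto
      finally show ?thesis using K C by (intro mult_left_mono mult_right_mono) auto
    qed
    also have "\<dots> \<le> ?K * ?m R"
      using bound[OF r'(1) x] m[OF pos(3)] K by (intro mult_left_mono) (auto simp: pos_le_divide_eq)
    finally show ?thesis using K m[OF pos(2)] by (simp add: field_simps)
  qed
  moreover have "0 < C2 / ?K" using C K by simp
  ultimately show ?thesis using C' \<beta>(1) unfolding lower_exponent_def by blast
qed

lemma lower_dim_mono_asymptotic:
  fixes \<mu> :: "'a::metric_space measure"
  assumes ps: "prob_space \<mu>" "sets \<mu> = sets borel"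
    and bdd: "bounded (UNIV :: 'a set)" and doub: "doubling \<mu>"
    and ev: "\<And>k. 1 < k \<Longrightarrow> \<forall>\<^sub>F x in at_right 0. \<Phi> x \<le> k * \<Psi> x"
    and nonneg: "\<forall>x\<in>{0<..<1}. 0 \<le> \<Phi> x"
  shows "lower_dim \<Phi> \<mu> \<le> lower_dim \<Psi> \<mu>"
proof -
  obtain D s where D: "0 < D" and s: "0 \<le> s" and growth: "\<And>u t z. 0 < u \<Longrightarrow> u \<le> t \<Longrightarrow>
      z \<in> supp \<mu> \<Longrightarrow> measure \<mu> (ball z t) \<le> D * (t / u) powr s * measure \<mu> (ball z u)"
    using doubling_power_growth[OF ps bdd doub] by blast
  have "ennreal \<alpha> \<le> lower_dim \<Psi> \<mu>" if \<alpha>: "lower_exponent \<Phi> \<mu> \<alpha>" for \<alpha>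
  proof (rule ennreal_le_epsilon)
    fix e :: real assume e: "0 < e"
    show "ennreal \<alpha> \<le> lower_dim \<Psi> \<mu> + ennreal e"
    proof (cases "\<alpha> \<le> e")
      case True
      thus ?thesis by (simp add: add_increasing ennreal_leI)
    next
      case False
      (* chosen so that the loss s * (k - 1) is at most e, also when s = 0 *)
      define k where "k = 1 + e / (s + 1)"
      have k: "1 < k" using e s by (simp add: k_def)
      have "s * (k - 1) \<le> e" using e s by (simp add: k_def field_simps)
      hence "lower_exponent \<Psi> \<mu> (\<alpha> - e)"
        using lower_exponent_transfer[OF D s growth ev[OF k] nonneg _ \<alpha>] k False by simp
      hence "ennreal (\<alpha> - e) + ennreal e \<le> lower_dim \<Psi> \<mu> + ennreal e"
        by (intro add_right_mono le_lower_dim)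
      thus ?thesis using e False by (simp flip: ennreal_plus)
    qed
  qed
  thus ?thesis unfolding lower_dim_eq_Sup[of \<Phi>] by (intro Sup_least) blast
qed

section \<open>Asymptotically equal dimension functions\<close>

text \<open>Where \<open>\<Psi>\<close> vanishes the quotient is 0 by convention, hence far from 1; so near 0 both
  functions are positive.\<close>

lemma ratio_tendsto_1_imp_eventually_le:
  fixes \<Phi> \<Psi> :: "real \<Rightarrow> real"
  assumes lim: "((\<lambda>x. \<Phi> x / \<Psi> x) \<longlongrightarrow> 1) (at_right 0)"
    and nonneg: "\<forall>x\<in>{0<..<1}. 0 \<le> \<Psi> x" and k: "1 < k"
  shows "\<forall>\<^sub>F x in at_right 0. \<Phi> x \<le> k * \<Psi> x" "\<forall>\<^sub>F x in at_right 0. \<Psi> x \<le> k * \<Phi> x"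
proof -
  have near: "\<forall>\<^sub>F x in at_right (0::real). 0 \<le> \<Psi> x"
    using nonneg unfolding eventually_at_right_field by (intro exI[of _ 1]) auto
  have up: "\<forall>\<^sub>F x in at_right 0. \<Phi> x / \<Psi> x < k"
    using order_tendstoD(2)[OF lim k] .
  have "1 / k < 1" using k by simp
  hence low: "\<forall>\<^sub>F x in at_right 0. 1 / k < \<Phi> x / \<Psi> x"
    using order_tendstoD(1)[OF lim] by blast
  have pos: "\<forall>\<^sub>F x in at_right 0. 0 < \<Psi> x"
    using near low
  proof eventually_elim
    case (elim x)
    thus ?case using k by (cases "\<Psi> x = 0") auto
  qed
  show "\<forall>\<^sub>F x in at_right 0. \<Phi> x \<le> k * \<Psi> x"
    using pos up by eventually_elim (simp add: field_simps)
  show "\<forall>\<^sub>F x in at_right 0. \<Psi> x \<le> k * \<Phi> x"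
    using pos low by eventually_elim (use k in \<open>simp add: field_simps\<close>)
qed

lemma upper_dim_asymptotic_eq:
  fixes \<mu> :: "'a::metric_space measure"
  assumes ps: "prob_space \<mu>" "sets \<mu> = sets borel"
    and nonneg: "\<forall>x\<in>{0<..<1}. 0 \<le> \<Phi> x" "\<forall>x\<in>{0<..<1}. 0 \<le> \<Psi> x"
    and lim: "((\<lambda>x. \<Phi> x / \<Psi> x) \<longlongrightarrow> 1) (at_right 0)"
  shows "upper_dim \<Phi> \<mu> = upper_dim \<Psi> \<mu>"
proof -
  note ev = ratio_tendsto_1_imp_eventually_le[OF lim nonneg(2)]
  show ?thesis
    using upper_dim_mono_asymptotic[OF ps ev(1) nonneg(1)]
      upper_dim_mono_asymptotic[OF ps ev(2) nonneg(2)]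
    by (intro order.antisym)
qed

lemma lower_dim_asymptotic_eq:
  fixes \<mu> :: "'a::metric_space measure"
  assumes ps: "prob_space \<mu>" "sets \<mu> = sets borel"
    and bdd: "bounded (UNIV :: 'a set)" and doub: "doubling \<mu>"
    and nonneg: "\<forall>x\<in>{0<..<1}. 0 \<le> \<Phi> x" "\<forall>x\<in>{0<..<1}. 0 \<le> \<Psi> x"
    and lim: "((\<lambda>x. \<Phi> x / \<Psi> x) \<longlongrightarrow> 1) (at_right 0)"
  shows "lower_dim \<Phi> \<mu> = lower_dim \<Psi> \<mu>"
proof -
  note ev = ratio_tendsto_1_imp_eventually_le[OF lim nonneg(2)]
  show ?thesis
    using lower_dim_mono_asymptotic[OF ps bdd doub ev(1) nonneg(1)]
      lower_dim_mono_asymptotic[OF ps bdd doub ev(2) nonneg(2)]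
    by (intro order.antisym)
qed

theorem corollary2p15:
  fixes \<Phi> \<Psi> :: "real \<Rightarrow> real"
    and \<mu> :: "'a::metric_space measure"
  assumes "dimension_function \<Phi>"
    and "dimension_function \<Psi>"
    and "bounded (UNIV :: 'a set)"
    and "prob_space \<mu>"
    and "sets \<mu> = sets borel"
  shows
    "(((\<lambda>x. \<Phi> x / \<Psi> x) \<longlongrightarrow> 1) (at_right 0) \<longrightarrow>
        upper_dim \<Phi> \<mu> = upper_dim \<Psi> \<mu> \<and>
        (doubling \<mu> \<longrightarrow> lower_dim \<Phi> \<mu> = lower_dim \<Psi> \<mu>)) \<and>
     (\<forall>\<theta>::real. (\<Phi> \<longlongrightarrow> \<theta>) (at_right 0) \<and> \<theta> \<noteq> 0 \<longrightarrow>
        upper_dim \<Phi> \<mu> = upper_dim (\<lambda>_. \<theta>) \<mu>) \<and>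
     (comparable \<Phi> \<Psi> \<longrightarrow> (upper_dim \<Phi> \<mu> < \<infinity> \<longleftrightarrow> upper_dim \<Psi> \<mu> < \<infinity>)) \<and>
     ((\<exists>s>0. \<forall>x\<in>{0<..<1}. \<Phi> x = s) \<and> (\<exists>t>0. \<forall>x\<in>{0<..<1}. \<Psi> x = t) \<longrightarrow>
        (upper_dim \<Phi> \<mu> < \<infinity> \<longleftrightarrow> upper_dim \<Psi> \<mu> < \<infinity>))"
proof -
  note ps = assms(4,5)
  have nonneg: "\<forall>x\<in>{0<..<1}. 0 \<le> \<Phi> x" "\<forall>x\<in>{0<..<1}. 0 \<le> \<Psi> x"
    using assms(1,2) by (auto simp: dimension_function_def)
  have limit: "upper_dim \<Phi> \<mu> = upper_dim (\<lambda>_. \<theta>) \<mu>"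
    if lim: "(\<Phi> \<longlongrightarrow> \<theta>) (at_right 0)" and "\<theta> \<noteq> 0" for \<theta>
  proof -
    have "\<forall>\<^sub>F x in at_right (0::real). 0 \<le> \<Phi> x"
      using nonneg unfolding eventually_at_right_field by (intro exI[of _ 1]) auto
    hence "0 \<le> \<theta>" by (intro tendsto_lowerbound[OF lim]) auto
    moreover have "((\<lambda>x. \<Phi> x / \<theta>) \<longlongrightarrow> 1) (at_right 0)"
      using tendsto_divide[OF lim tendsto_const[of \<theta>]] \<open>\<theta> \<noteq> 0\<close> by simp
    ultimately show ?thesis by (intro upper_dim_asymptotic_eq[OF ps nonneg(1)]) auto
  qed
  have const: "comparable \<Phi> \<Psi>"
    if st: "0 < s" "\<forall>x\<in>{0<..<1}. \<Phi> x = s" "0 < t" "\<forall>x\<in>{0<..<1}. \<Psi> x = t" for s t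
    unfolding comparable_def using st by (intro exI[of _ "t / s"] conjI) auto
  note finite_iff = comparable_upper_dim_finite_iff[OF ps nonneg]
  show ?thesis
  proof (intro conjI impI allI)
    show "upper_dim \<Phi> \<mu> = upper_dim \<Psi> \<mu>" if "((\<lambda>x. \<Phi> x / \<Psi> x) \<longlongrightarrow> 1) (at_right 0)"
      using that by (rule upper_dim_asymptotic_eq[OF ps nonneg])
    show "lower_dim \<Phi> \<mu> = lower_dim \<Psi> \<mu>"
      if "((\<lambda>x. \<Phi> x / \<Psi> x) \<longlongrightarrow> 1) (at_right 0)" "doubling \<mu>"
      by (rule lower_dim_asymptotic_eq[OF ps assms(3) that(2) nonneg that(1)])
    show "upper_dim \<Phi> \<mu> = upper_dim (\<lambda>_. \<theta>) \<mu>" if "(\<Phi> \<longlongrightarrow> \<theta>) (at_right 0) \<and> \<theta> \<noteq> 0" for \<theta>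
      using that limit by simp
    show "upper_dim \<Phi> \<mu> < \<infinity> \<longleftrightarrow> upper_dim \<Psi> \<mu> < \<infinity>" if "comparable \<Phi> \<Psi>"
      using that by (rule finite_iff)
    show "upper_dim \<Phi> \<mu> < \<infinity> \<longleftrightarrow> upper_dim \<Psi> \<mu> < \<infinity>"
      if "(\<exists>s>0. \<forall>x\<in>{0<..<1}. \<Phi> x = s) \<and> (\<exists>t>0. \<forall>x\<in>{0<..<1}. \<Psi> x = t)"
    proof -
      from that obtain s t where "0 < s" "\<forall>x\<in>{0<..<1}. \<Phi> x = s" "0 < t" "\<forall>x\<in>{0<..<1}. \<Psi> x = t"
        by (elim conjE exE)
      thus ?thesis by (intro finite_iff const)
    qed
  qed
qed

end
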